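(* Let $(x_0,y_0)\in\operatorname{dom}h_1\times\operatorname{dom}h_2$, $\bar\varepsilon>0$ and $\lambda=\bar\varepsilon/(32M^2)$. Then the number of iterations of CS-SPP$(x_0,y_0,\lambda)$ to find an $\bar\varepsilon$-saddle-point $(\bar x_k,\bar y_k)$ of the saddle-point problem, where $\bar x_k=\frac1k\sum_{i=1}^kx_i$ and $\bar y_k=\frac1k\sum_{i=1}^ky_i$, is at most $128M^2D^2/\bar\varepsilon^2$.
   Context: Saddle-point problem. $f(x,y)$, $(x,y)\in\mathbb R^n\times\mathbb R^m$, is convex in $x$ and concave in $y$; $h_1:\mathbb R^n\to\mathbb R\cup\{+\infty\}$ and $h_2:\mathbb R^m\to\mathbb R\cup\{+\infty\}$ are proper lower semicontinuous convex with $\operatorname{dom}h_1\times\operatorname{dom}h_2\subset\operatorname{dom}f$. The problem is $\min_x\max_y\{\phi(x,y)=f(x,y)+h_1(x)-h_2(y)\}$. Assumptions: there are maps $f_x',f_y'$ on $\operatorname{dom}h_1\times\operatorname{dom}h_2$ with $f_x'(u,v)$ a subgradient of $f(\cdot,v)$ at $u$ and $f_y'(u,v)$ a supergradient of $f(u,\cdot)$ at $v$; $\|f_x'(u,v)\|\le M$ and $\|f_y'(u,v)\|\le M$ for all $(u,v)\in\operatorname{dom}h_1\times\operatorname{dom}h_2$, for some $M>0$; $\operatorname{dom}h_1\times\operatorname{dom}h_2$ is bounded with finite diameter $D>0$; the proximal mappings of $h_1$ and $h_2$ are easy to compute; the set of saddle points is nonempty. A pair $(x,y)\in\operatorname{dom}h_1\times\operatorname{dom}h_2$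 is an $\bar\varepsilon$-saddle-point if $0\in\partial_{\bar\varepsilon}[\phi(\cdot,y)-\phi(x,\cdot)](x,y)$, i.e. $\phi(x,v)-\phi(u,y)\le\bar\varepsilon$ for all $(u,v)\in\operatorname{dom}h_1\times\operatorname{dom}h_2$. CS-SPP$(x_0,y_0,\lambda)$ (composite subgradient method): for $k\ge1$, $x_k=\operatorname{argmin}_u\{f(x_{k-1},y_{k-1})+\langle f_x'(x_{k-1},y_{k-1}),u-x_{k-1}\rangle+h_1(u)+\frac1{2\lambda}\|u-x_{k-1}\|^2\}$, $y_k=\operatorname{argmin}_v\{-f(x_{k-1},y_{k-1})-\langle f_y'(x_{k-1},y_{k-1}),v-y_{k-1}\rangle+h_2(v)+\frac1{2\lambda}\|v-y_{k-1}\|^2\}$.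
   Formalization: The bound is read as max(1, 128M²D²/ε̄²): when 128M²D²/ε̄² < 1 the literal bound would allow only k = 0 iterations, for which the averages are undefined, so at least one iteration is made. *)

theory Defs
  imports "HOL-Analysis.Analysis"
begin

definition edom :: "('a \<Rightarrow> ereal) \<Rightarrow> 'a set" where
  "edom h = {x. h x < \<infinity>}"

definition proper_fun :: "('a \<Rightarrow> ereal) \<Rightarrow> bool" where
  "proper_fun h \<longleftrightarrow> (\<forall>x. h x \<noteq> -\<infinity>) \<and> edom h \<noteq> {}"

definition lsc_fun :: "('a::topological_space \<Rightarrow> ereal) \<Rightarrow> bool" where
  "lsc_fun h \<longleftrightarrow> (\<forall>x. h x \<le> Liminf (at x) h)"

(* Convexity through the epigraph, so that it is meaningful for functions that may take
   both values \<infinity> and -\<infinity>. *)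
definition econvex_fun :: "('a::real_vector \<Rightarrow> ereal) \<Rightarrow> bool" where
  "econvex_fun h \<longleftrightarrow> convex {(x, r::real). h x \<le> ereal r}"

definition econcave_fun :: "('a::real_vector \<Rightarrow> ereal) \<Rightarrow> bool" where
  "econcave_fun h \<longleftrightarrow> econvex_fun (\<lambda>x. - h x)"

(* The points where a convex-concave function is finite. *)
definition saddle_dom :: "('a \<Rightarrow> 'b \<Rightarrow> ereal) \<Rightarrow> ('a \<times> 'b) set" where
  "saddle_dom f = {(x, y). \<bar>f x y\<bar> \<noteq> \<infinity>}"

definition is_subgradient :: "('a::real_inner \<Rightarrow> ereal) \<Rightarrow> 'a \<Rightarrow> 'a \<Rightarrow> bool" where
  "is_subgradient g u s \<longleftrightarrow> (\<forall>w. g u + ereal (s \<bullet> (w - u)) \<le> g w)"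

definition is_supergradient :: "('a::real_inner \<Rightarrow> ereal) \<Rightarrow> 'a \<Rightarrow> 'a \<Rightarrow> bool" where
  "is_supergradient g u s \<longleftrightarrow> (\<forall>w. g w \<le> g u + ereal (s \<bullet> (w - u)))"

(* Only evaluated below at points of edom h1 \<times> edom h2, where all three terms are finite. *)
definition spp_obj ::
  "('a \<Rightarrow> 'b \<Rightarrow> ereal) \<Rightarrow> ('a \<Rightarrow> ereal) \<Rightarrow> ('b \<Rightarrow> ereal) \<Rightarrow> 'a \<Rightarrow> 'b \<Rightarrow> ereal" where
  "spp_obj f h1 h2 x y = f x y + h1 x - h2 y"

definition is_saddle_point ::
  "('a \<Rightarrow> 'b \<Rightarrow> ereal) \<Rightarrow> ('a \<Rightarrow> ereal) \<Rightarrow> ('b \<Rightarrow> ereal) \<Rightarrow> 'a \<Rightarrow> 'b \<Rightarrow> bool" where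
  "is_saddle_point f h1 h2 x y \<longleftrightarrow> x \<in> edom h1 \<and> y \<in> edom h2 \<and>
     (\<forall>u\<in>edom h1. \<forall>v\<in>edom h2.
        spp_obj f h1 h2 x v \<le> spp_obj f h1 h2 x y \<and>
        spp_obj f h1 h2 x y \<le> spp_obj f h1 h2 u y)"

(* The inequality says that 0 is an eps-subgradient at (x, y) of
   (u, v) \<mapsto> spp_obj u y - spp_obj x v, a function that vanishes at (x, y)
   and is taken to be \<infinity> outside edom h1 \<times> edom h2. *)
definition is_eps_saddle_point ::
  "('a \<Rightarrow> 'b \<Rightarrow> ereal) \<Rightarrow> ('a \<Rightarrow> ereal) \<Rightarrow> ('b \<Rightarrow> ereal) \<Rightarrow> real \<Rightarrow> 'a \<Rightarrow> 'b \<Rightarrow> bool" where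
  "is_eps_saddle_point f h1 h2 \<epsilon> x y \<longleftrightarrow> x \<in> edom h1 \<and> y \<in> edom h2 \<and>
     (\<forall>u\<in>edom h1. \<forall>v\<in>edom h2.
        spp_obj f h1 h2 x v - spp_obj f h1 h2 u y \<le> ereal \<epsilon>)"

definition cs_step_x ::
  "('a::real_inner \<Rightarrow> 'b::real_inner \<Rightarrow> ereal) \<Rightarrow> ('a \<Rightarrow> 'b \<Rightarrow> 'a) \<Rightarrow> ('a \<Rightarrow> ereal) \<Rightarrow> real
     \<Rightarrow> 'a \<Rightarrow> 'b \<Rightarrow> 'a" where
  "cs_step_x f fx h1 lam x y =
     arg_min (\<lambda>u. f x y + ereal (fx x y \<bullet> (u - x)) + h1 u
                  + ereal (1 / (2 * lam) * (norm (u - x))\<^sup>2)) (\<lambda>_. True)"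

definition cs_step_y ::
  "('a::real_inner \<Rightarrow> 'b::real_inner \<Rightarrow> ereal) \<Rightarrow> ('a \<Rightarrow> 'b \<Rightarrow> 'b) \<Rightarrow> ('b \<Rightarrow> ereal) \<Rightarrow> real
     \<Rightarrow> 'a \<Rightarrow> 'b \<Rightarrow> 'b" where
  "cs_step_y f fy h2 lam x y =
     arg_min (\<lambda>v. - f x y - ereal (fy x y \<bullet> (v - y)) + h2 v
                  + ereal (1 / (2 * lam) * (norm (v - y))\<^sup>2)) (\<lambda>_. True)"

(* Both components of an iterate are computed from the previous pair. *)
primrec cs_spp ::
  "('a::real_inner \<Rightarrow> 'b::real_inner \<Rightarrow> ereal) \<Rightarrow> ('a \<Rightarrow> 'b \<Rightarrow> 'a) \<Rightarrow> ('a \<Rightarrow> 'b \<Rightarrow> 'b)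
     \<Rightarrow> ('a \<Rightarrow> ereal) \<Rightarrow> ('b \<Rightarrow> ereal) \<Rightarrow> 'a \<Rightarrow> 'b \<Rightarrow> real \<Rightarrow> nat \<Rightarrow> 'a \<times> 'b" where
  "cs_spp f fx fy h1 h2 x0 y0 lam 0 = (x0, y0)"
| "cs_spp f fx fy h1 h2 x0 y0 lam (Suc k) =
     (case cs_spp f fx fy h1 h2 x0 y0 lam k of
        (x, y) \<Rightarrow> (cs_step_x f fx h1 lam x y, cs_step_y f fy h2 lam x y))"

(* The average of the first k iterates z 1, ..., z k; the starting point z 0 is not included. *)
definition iter_avg :: "(nat \<Rightarrow> 'a::real_vector) \<Rightarrow> nat \<Rightarrow> 'a" where
  "iter_avg z k = (1 / real k) *\<^sub>R (\<Sum>i=1..k. z i)"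

end

theory Submission
  imports Defs
begin

text \<open>Fix a comparison point \<open>(u, v)\<close> in the domain. Each player minimizes a linearization of
  the payoff plus \<open>h\<close> plus a quadratic term of strong convexity \<open>1/lam\<close>, so the standard
  three-point inequality (\<open>prox_three_point\<close>) bounds the progress of the step by the decrease of the
  squared distance to \<open>u\<close> or \<open>v\<close> divided by \<open>2 lam\<close> (\<open>cs_step_x_progress\<close>). The
  subgradient inequalities replace the linearizations by values of \<open>f\<close>; when the two players'
  inequalities are added, \<open>f(x i, y i)\<close> cancels, and what remains is the gap
  \<open>\<phi>(x (i+1), v) - \<phi>(u, y (i+1))\<close>, up to replacing old iterates by new ones in \<open>f\<close>. That
  replacement costs \<open>M\<close> times the step length, since bounded subgradients make \<open>f\<close> Lipschitz
  in each variable, and the remaining negative quadratic term absorbs the cost at the price of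
  \<open>2 lam M\<^sup>2\<close> per player.

  Summing over \<open>i\<close> telescopes, the total decrease of the squared distance is at most \<open>D\<^sup>2\<close>, and
  Jensen's inequality (\<open>iter_avg_Jensen\<close>) passes to the averages: after \<open>k\<close> steps the gap is at most
  \<open>4 lam M\<^sup>2 + D\<^sup>2 / (2 lam k) = \<epsilon>/8 + 16 M\<^sup>2 D\<^sup>2 / (\<epsilon> k)\<close>. This is well below \<open>\<epsilon>\<close> already
  for \<open>k\<close> equal to half of \<open>128 M\<^sup>2 D\<^sup>2 / \<epsilon>\<^sup>2\<close>, so the bound may be rounded down to an integer.

  The step is defined by a choice operator, so none of this applies until a minimizer is
  known to exist. Existence follows from lower semicontinuity and the compactness of the
  closure of the bounded domain (\<open>lsc_perturbed_attains_min\<close>).\<close>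

section \<open>Extended-valued convex functions on their domain\<close>

lemma finite_on_edom:
  assumes "proper_fun h" "u \<in> edom h"
  shows "h u = ereal (real_of_ereal (h u))"
  using assms by (cases "h u") (auto simp: proper_fun_def edom_def)

lemma econvex_convex_on:
  fixes g :: "'a::real_vector \<Rightarrow> ereal"
  assumes g: "econvex_fun g" and C: "convex C"
    and fin: "\<And>u. u \<in> C \<Longrightarrow> \<bar>g u\<bar> \<noteq> \<infinity>"
  shows "convex_on C (\<lambda>u. real_of_ereal (g u))"
proof (rule convex_onI)
  fix t x y assume t: "0 < t" "t < (1::real)" and xy: "x \<in> C" "y \<in> C"
  let ?z = "(1 - t) *\<^sub>R x + t *\<^sub>R y"
  have z: "?z \<in> C" using convexD_alt[OF C xy] t by simp
  have epi: "(w, real_of_ereal (g w)) \<in> {(x, r::real). g x \<le> ereal r}" if "w \<in> C" for w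
    using fin[OF that] by (simp add: ereal_real')
  have "(1 - t) *\<^sub>R (x, real_of_ereal (g x)) + t *\<^sub>R (y, real_of_ereal (g y))
      \<in> {(x, r::real). g x \<le> ereal r}"
    using convexD_alt[OF g[unfolded econvex_fun_def] epi[OF xy(1)] epi[OF xy(2)]] t by simp
  then have "g ?z \<le> ereal ((1 - t) * real_of_ereal (g x) + t * real_of_ereal (g y))"
    by simp
  then show "real_of_ereal (g ?z) \<le> (1 - t) * real_of_ereal (g x) + t * real_of_ereal (g y)"
    using fin[OF z] by (cases "g ?z") auto
qed (rule C)

lemma convex_edom:
  fixes h :: "'a::real_vector \<Rightarrow> ereal"
  assumes h: "proper_fun h" "econvex_fun h"
  shows "convex (edom h)"
proof -
  have "edom h = fst ` {(x, r::real). h x \<le> ereal r}"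
  proof (intro set_eqI iffI)
    fix x assume "x \<in> edom h"
    then have "h x \<le> ereal (real_of_ereal (h x))"
      using finite_on_edom[OF h(1)] by simp
    then show "x \<in> fst ` {(x, r::real). h x \<le> ereal r}" by force
  next
    fix x assume "x \<in> fst ` {(x, r::real). h x \<le> ereal r}"
    then show "x \<in> edom h" by (cases "h x") (auto simp: edom_def)
  qed
  then show ?thesis
    using h(2) convex_linear_image[OF linear_fst] unfolding econvex_fun_def by metis
qed

lemma convex_on_edom:
  fixes h :: "'a::real_vector \<Rightarrow> ereal"
  assumes h: "proper_fun h" "econvex_fun h"
  shows "convex_on (edom h) (\<lambda>u. real_of_ereal (h u))"
proof (rule econvex_convex_on[OF h(2) convex_edom[OF h]])
  show "\<bar>h u\<bar> \<noteq> \<infinity>" if "u \<in> edom h" for u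
    by (subst finite_on_edom[OF h(1) that]) simp
qed

lemma iter_avg_mem:
  assumes "convex C" "\<And>i. z i \<in> C" "k \<ge> 1"
  shows "iter_avg z k \<in> C"
proof -
  have "(\<Sum>i=1..k. (1 / real k) *\<^sub>R z i) \<in> C"
    using assms by (intro convex_sum) auto
  then show ?thesis by (simp add: iter_avg_def scaleR_right.sum)
qed

lemma iter_avg_Jensen:
  fixes \<phi> :: "'a::real_vector \<Rightarrow> real"
  assumes "convex_on C \<phi>" "\<And>i. z i \<in> C" "k \<ge> 1"
  shows "real k * \<phi> (iter_avg z k) \<le> (\<Sum>i=1..k. \<phi> (z i))"
proof -
  have "\<phi> (\<Sum>i=1..k. (1 / real k) *\<^sub>R z i) \<le> (\<Sum>i=1..k. (1 / real k) * \<phi> (z i))"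
    using assms by (intro convex_on_sum) auto
  then have "\<phi> (iter_avg z k) \<le> (\<Sum>i=1..k. \<phi> (z i)) / real k"
    by (simp add: iter_avg_def scaleR_right.sum sum_divide_distrib)
  then show ?thesis using assms(3) by (simp add: field_simps)
qed

lemma is_subgradient_real:
  assumes "is_subgradient g u s" "\<bar>g u\<bar> \<noteq> \<infinity>" "\<bar>g w\<bar> \<noteq> \<infinity>"
  shows "real_of_ereal (g u) + s \<bullet> (w - u) \<le> real_of_ereal (g w)"
proof -
  have "g u + ereal (s \<bullet> (w - u)) \<le> g w" using assms(1) by (simp add: is_subgradient_def)
  then show ?thesis using assms(2,3) by (cases "g u"; cases "g w") auto
qed

lemma is_supergradient_uminus:
  "is_supergradient g u s \<longleftrightarrow> is_subgradient (\<lambda>w. - g w) u (- s)"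
proof -
  have "g w \<le> g u + ereal c \<longleftrightarrow> - g u + ereal (- c) \<le> - g w" for w c
    by (cases "g u"; cases "g w") auto
  then show ?thesis by (simp add: is_supergradient_def is_subgradient_def)
qed

section \<open>The proximal step\<close>

lemma lsc_fun_open_superlevel:
  assumes h: "lsc_fun h"
  shows "open {z. c < h z}"
proof (subst open_subopen, safe)
  fix z assume c: "c < h z"
  then have "c < Liminf (at z) h"
    using h[unfolded lsc_fun_def, rule_format, of z] by (rule less_le_trans)
  then have "eventually (\<lambda>w. c < h w) (at z)" by (rule less_LiminfD)
  then have "eventually (\<lambda>w. c < h w) (nhds z)"
    using c by (auto simp: eventually_at_filter elim: eventually_mono)
  then show "\<exists>T. open T \<and> z \<in> T \<and> T \<subseteq> {z. c < h z}"
    by (auto simp: eventually_nhds)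
qed

text \<open>If there were no minimizer, the closure of the domain is covered by the superlevel sets of the
  perturbed function at the values it takes on the domain. A finite subcover exists, but the point with the least
  value among the finitely many chosen ones is not covered.\<close>

lemma lsc_perturbed_attains_min:
  fixes h :: "'a::heine_borel \<Rightarrow> ereal" and r :: "'a \<Rightarrow> real"
  assumes h: "proper_fun h" "lsc_fun h" and bd: "bounded (edom h)"
    and r: "continuous_on UNIV r"
  obtains x where "\<And>u. h x + ereal (r x) \<le> h u + ereal (r u)"
proof -
  let ?g = "\<lambda>u. h u + ereal (r u)"
  have "\<exists>x. \<forall>u. ?g x \<le> ?g u"
  proof (rule ccontr)
    assume no: "\<nexists>x. \<forall>u. ?g x \<le> ?g u"
    define U where "U y = {z. ?g y < ?g z}" for y
    have opn: "open (U y)" if y: "y \<in> edom h" for y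
    proof -
      define c where "c = real_of_ereal (h y) + r y"
      have gy: "?g y = ereal c"
        using finite_on_edom[OF h(1) y] by (metis c_def plus_ereal.simps(1))
      \<comment> \<open>Separating the two summands by a real number makes the superlevel set of the
        sum a union of open sets.\<close>
      have "U y = (\<Union>a::real. {z. ereal a < h z} \<inter> {z. c - r z < a})"
      proof (intro set_eqI iffI)
        fix z assume "z \<in> U y"
        then have "ereal (c - r z) < h z"
          using h(1) by (cases "h z") (auto simp: U_def gy proper_fun_def)
        then obtain a where "ereal (c - r z) < ereal a" "ereal a < h z"
          by (metis ereal_dense2)
        then show "z \<in> (\<Union>a::real. {z. ereal a < h z} \<inter> {z. c - r z < a})" by auto
      next
        fix z assume "z \<in> (\<Union>a::real. {z. ereal a < h z} \<inter> {z. c - r z < a})"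
        then obtain a where "ereal a < h z" "c - r z < a" by auto
        then show "z \<in> U y" by (cases "h z") (auto simp: U_def gy)
      qed
      also have "open \<dots>"
        using r by (intro open_UN ballI open_Int lsc_fun_open_superlevel[OF h(2)]
            open_Collect_less continuous_intros)
      finally show ?thesis .
    qed
    have cover: "closure (edom h) \<subseteq> (\<Union>y\<in>edom h. U y)"
    proof
      fix z
      obtain y where y: "?g y < ?g z" using no by (metis not_le)
      then have "y \<in> edom h" by (auto simp: edom_def)
      then show "z \<in> (\<Union>y\<in>edom h. U y)" using y by (auto simp: U_def)
    qed
    have "compact (closure (edom h))" using bd by (simp add: compact_closure)
    then obtain Y where Y: "Y \<subseteq> edom h" "finite Y" "closure (edom h) \<subseteq> (\<Union>y\<in>Y. U y)"
      using compactE_image[OF _ opn cover] by metis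
    have "Y \<noteq> {}"
      using Y(3) h(1) closure_subset[of "edom h"] by (auto simp: proper_fun_def)
    then obtain m where m: "m \<in> Y" "\<And>y. y \<in> Y \<Longrightarrow> ?g m \<le> ?g y"
      using ex_min_if_finite[of "?g ` Y"] Y(2)
      by (metis (no_types, lifting) arg_min_if_finite(1) arg_min_least)
    then have "m \<in> (\<Union>y\<in>Y. U y)" using Y closure_subset by blast
    then show False using m(2) by (auto simp: U_def not_less[symmetric])
  qed
  then show ?thesis using that by blast
qed

text \<open>The objective of the step is \<open>1/lam\<close>-strongly convex, which is where the
  term \<open>\<parallel>u - x\<parallel>\<^sup>2\<close> comes from: along the segment from the minimizer \<open>x\<close>
  to \<open>u\<close> the one-sided derivative at \<open>x\<close> is nonnegative.\<close>

lemma prox_three_point: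
  fixes H :: "'a::real_inner \<Rightarrow> real"
  assumes H: "convex_on C H" and x: "x \<in> C" and u: "u \<in> C" and lam: "lam > 0"
    and min: "\<And>w. w \<in> C \<Longrightarrow> H x + s \<bullet> (x - p) + 1 / (2 * lam) * (norm (x - p))\<^sup>2
                        \<le> H w + s \<bullet> (w - p) + 1 / (2 * lam) * (norm (w - p))\<^sup>2"
  shows "H x + s \<bullet> (x - p) + 1 / (2 * lam) * (norm (x - p))\<^sup>2
           + 1 / (2 * lam) * (norm (u - x))\<^sup>2
         \<le> H u + s \<bullet> (u - p) + 1 / (2 * lam) * (norm (u - p))\<^sup>2"
proof -
  define A where "A = H u - H x + s \<bullet> (u - x) + (1 / lam) * ((x - p) \<bullet> (u - x))"
  define B where "B = 1 / (2 * lam) * (norm (u - x))\<^sup>2"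
  have sm: "0 \<le> A + t * B" if t: "0 < t" "t < 1" for t
  proof -
    let ?w = "(1 - t) *\<^sub>R x + t *\<^sub>R u"
    have w: "?w \<in> C" using convexD_alt[OF convex_on_imp_convex[OF H] x u] t by simp
    have Hw: "H ?w \<le> (1 - t) * H x + t * H u" using convex_onD[OF H _ _ x u] t by simp
    have wp: "?w - p = (x - p) + t *\<^sub>R (u - x)" by (simp add: algebra_simps)
    have n: "(norm (?w - p))\<^sup>2
        = (norm (x - p))\<^sup>2 + 2 * t * ((x - p) \<bullet> (u - x)) + t\<^sup>2 * (norm (u - x))\<^sup>2"
      unfolding wp power2_norm_eq_inner
      by (simp add: inner_add_left inner_add_right inner_commute power2_eq_square)
    have "0 \<le> t * (A + t * B)"
    proof -
      have "H x + s \<bullet> (x - p) + 1 / (2 * lam) * (norm (x - p))\<^sup>2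
          \<le> (1 - t) * H x + t * H u + (s \<bullet> (x - p) + t * (s \<bullet> (u - x)))
            + 1 / (2 * lam) * (norm (?w - p))\<^sup>2"
        using min[OF w] Hw by (simp add: wp inner_add_right)
      moreover have "1 / (2 * lam) * (norm (?w - p))\<^sup>2
          = 1 / (2 * lam) * (norm (x - p))\<^sup>2 + t * ((1 / lam) * ((x - p) \<bullet> (u - x))) + t * (t * B)"
        unfolding n B_def by (simp add: add_divide_distrib power2_eq_square)
      ultimately show ?thesis
        by (simp add: A_def algebra_simps)
    qed
    then show ?thesis using t by (simp add: zero_le_mult_iff)
  qed
  have "0 \<le> A"
  proof (rule tendsto_lowerbound)
    show "((\<lambda>t. A + t * B) \<longlongrightarrow> A) (at_right 0)"
      by (auto intro!: tendsto_eq_intros)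
    show "eventually (\<lambda>t. 0 \<le> A + t * B) (at_right (0::real))"
      using sm by (auto simp: eventually_at_right_field intro!: exI[of _ 1])
  qed simp
  moreover have "(norm (u - p))\<^sup>2
      = (norm (u - x))\<^sup>2 + 2 * ((x - p) \<bullet> (u - x)) + (norm (x - p))\<^sup>2"
  proof -
    have "u - p = (u - x) + (x - p)" by simp
    then show ?thesis unfolding power2_norm_eq_inner
      by (simp only: inner_add_left inner_add_right inner_commute)
  qed
  moreover have "s \<bullet> (u - p) = s \<bullet> (u - x) + s \<bullet> (x - p)"
    by (simp add: inner_diff_right)
  ultimately show ?thesis by (simp add: A_def add_divide_distrib)
qed

text \<open>The quadratic term left over from the three-point inequality has to absorb
  \<open>M * norm (x' - x)\<close> twice: once for linearizing at the old point \<open>x\<close>, and once for the summand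
  on the left-hand side, which later pays for replacing \<open>f(x, v)\<close> by \<open>f(x', v)\<close> at the opponent's
  comparison point \<open>v\<close>. The constant \<open>2 lam M\<^sup>2\<close> is the maximum over \<open>d\<close> of
  \<open>2 M d - d\<^sup>2 / (2 lam)\<close>.\<close>

lemma cs_step_x_progress:
  fixes f :: "'a::euclidean_space \<Rightarrow> 'b::real_inner \<Rightarrow> ereal"
  assumes h: "proper_fun h" "lsc_fun h" "econvex_fun h" "bounded (edom h)"
    and fin: "\<bar>f x y\<bar> \<noteq> \<infinity>" and M: "norm (fx x y) \<le> M" and lam: "lam > 0"
  defines "x' \<equiv> cs_step_x f fx h lam x y"
  shows "x' \<in> edom h"
    and "u \<in> edom h \<Longrightarrow>
      real_of_ereal (h x') + M * norm (x' - x)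
        \<le> real_of_ereal (h u) + fx x y \<bullet> (u - x)
          + ((norm (u - x))\<^sup>2 - (norm (u - x'))\<^sup>2) / (2 * lam) + 2 * lam * M\<^sup>2"
proof -
  define s where "s = fx x y"
  define r where "r u = real_of_ereal (f x y) + s \<bullet> (u - x) + 1 / (2 * lam) * (norm (u - x))\<^sup>2"
    for u
  have f_real: "f x y = ereal (real_of_ereal (f x y))" using fin by (simp add: ereal_real')
  have obj: "f x y + ereal (s \<bullet> (u - x)) + h u + ereal (1 / (2 * lam) * (norm (u - x))\<^sup>2)
      = h u + ereal (r u)" for u
    by (subst f_real) (cases "h u", simp_all add: r_def)
  have "continuous_on UNIV r" unfolding r_def by (intro continuous_intros)
  then obtain m where "\<And>u. h m + ereal (r m) \<le> h u + ereal (r u)"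
    using lsc_perturbed_attains_min[OF h(1,2,4)] by metis
  then have "is_arg_min (\<lambda>u. h u + ereal (r u)) (\<lambda>_. True) m"
    by (auto simp: is_arg_min_def not_less)
  moreover have "x' = arg_min (\<lambda>u. h u + ereal (r u)) (\<lambda>_. True)"
    unfolding x'_def cs_step_x_def s_def[symmetric] obj ..
  ultimately have "is_arg_min (\<lambda>u. h u + ereal (r u)) (\<lambda>_. True) x'"
    unfolding arg_min_def by (metis someI)
  then have min: "h x' + ereal (r x') \<le> h u + ereal (r u)" for u
    by (auto simp: is_arg_min_def not_less)
  obtain a where "a \<in> edom h" using h(1) by (auto simp: proper_fun_def)
  then show x': "x' \<in> edom h"
    using min[of a] by (cases "h a"; cases "h x'") (auto simp: edom_def)
  assume u: "u \<in> edom h"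
  let ?H = "\<lambda>u. real_of_ereal (h u)"
  have cvx: "convex_on (edom h) ?H" by (rule convex_on_edom[OF h(1,3)])
  have "?H x' + r x' \<le> ?H w + r w" if "w \<in> edom h" for w
    using min[of w] finite_on_edom[OF h(1) that] finite_on_edom[OF h(1) x']
    by (metis ereal_less_eq(3) plus_ereal.simps(1))
  then have "?H x' + s \<bullet> (x' - x) + 1 / (2 * lam) * (norm (x' - x))\<^sup>2
           + 1 / (2 * lam) * (norm (u - x'))\<^sup>2
         \<le> ?H u + s \<bullet> (u - x) + 1 / (2 * lam) * (norm (u - x))\<^sup>2"
    using prox_three_point[OF cvx x' u lam, of s x] by (simp add: r_def add.assoc)
  moreover have "- (M * norm (x' - x)) \<le> s \<bullet> (x' - x)"
    using Cauchy_Schwarz_ineq2[of s "x' - x"] mult_right_mono[OF M, of "norm (x' - x)"]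
    by (simp add: s_def abs_le_iff)
  moreover have "2 * M * norm (x' - x) \<le> 1 / (2 * lam) * (norm (x' - x))\<^sup>2 + 2 * lam * M\<^sup>2"
  proof -
    have "0 \<le> (norm (x' - x) - 2 * lam * M)\<^sup>2 / (2 * lam)" using lam by simp
    then show ?thesis using lam by (simp add: power2_eq_square field_simps)
  qed
  ultimately show "?H x' + M * norm (x' - x)
        \<le> ?H u + fx x y \<bullet> (u - x)
          + ((norm (u - x))\<^sup>2 - (norm (u - x'))\<^sup>2) / (2 * lam) + 2 * lam * M\<^sup>2"
    by (simp add: s_def diff_divide_distrib)
qed

text \<open>Maximizing over \<open>v\<close> is minimizing for \<open>-f\<close>, so every fact about the first
  player's step transfers to the second player.\<close>

lemma cs_step_y_eq_cs_step_x:
  "cs_step_y f fy h lam x y = cs_step_x (\<lambda>v u. - f u v) (\<lambda>v u. - fy u v) h lam y x"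
  by (simp add: cs_step_y_def cs_step_x_def minus_ereal_def)

section \<open>Convergence of the averaged iterates\<close>

theorem theoremC1:
  fixes f :: "real ^ 'n \<Rightarrow> real ^ 'm \<Rightarrow> ereal"
    and h1 :: "real ^ 'n \<Rightarrow> ereal"
    and h2 :: "real ^ 'm \<Rightarrow> ereal"
    and fx :: "real ^ 'n \<Rightarrow> real ^ 'm \<Rightarrow> real ^ 'n"
    and fy :: "real ^ 'n \<Rightarrow> real ^ 'm \<Rightarrow> real ^ 'm"
    and x0 :: "real ^ 'n" and y0 :: "real ^ 'm"
    and M D \<epsilon> lam :: real
    and x :: "nat \<Rightarrow> real ^ 'n" and y :: "nat \<Rightarrow> real ^ 'm"
  assumes f_convex: "\<And>v. econvex_fun (\<lambda>u. f u v)"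
    and f_concave: "\<And>u. econcave_fun (\<lambda>v. f u v)"
    and h1: "proper_fun h1" "lsc_fun h1" "econvex_fun h1"
    and h2: "proper_fun h2" "lsc_fun h2" "econvex_fun h2"
    and dom_f: "edom h1 \<times> edom h2 \<subseteq> saddle_dom f"
    and fx: "\<And>u v. u \<in> edom h1 \<Longrightarrow> v \<in> edom h2 \<Longrightarrow> is_subgradient (\<lambda>w. f w v) u (fx u v)"
    and fy: "\<And>u v. u \<in> edom h1 \<Longrightarrow> v \<in> edom h2 \<Longrightarrow> is_supergradient (\<lambda>w. f u w) v (fy u v)"
    and M_pos: "M > 0"
    and fx_bound: "\<And>u v. u \<in> edom h1 \<Longrightarrow> v \<in> edom h2 \<Longrightarrow> norm (fx u v) \<le> M"
    and fy_bound: "\<And>u v. u \<in> edom h1 \<Longrightarrow> v \<in> edom h2 \<Longrightarrow> norm (fy u v) \<le> M"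
    and dom_bounded: "bounded (edom h1 \<times> edom h2)"
    and D_def: "D = diameter (edom h1 \<times> edom h2)"
    and D_pos: "D > 0"
    and saddle_exists: "\<exists>xs ys. is_saddle_point f h1 h2 xs ys"
    and start: "(x0, y0) \<in> edom h1 \<times> edom h2"
    and eps_pos: "\<epsilon> > 0"
    and lam_def: "lam = \<epsilon> / (32 * M\<^sup>2)"
    and x_def: "\<And>k. x k = fst (cs_spp f fx fy h1 h2 x0 y0 lam k)"
    and y_def: "\<And>k. y k = snd (cs_spp f fx fy h1 h2 x0 y0 lam k)"
  shows "(\<exists>k\<ge>1. real k \<le> max 1 (128 * M\<^sup>2 * D\<^sup>2 / \<epsilon>\<^sup>2) \<and>
            is_eps_saddle_point f h1 h2 \<epsilon> (iter_avg x k) (iter_avg y k)) \<and>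
         (\<forall>k\<ge>1. 128 * M\<^sup>2 * D\<^sup>2 / \<epsilon>\<^sup>2 \<le> real k \<longrightarrow>
            is_eps_saddle_point f h1 h2 \<epsilon> (iter_avg x k) (iter_avg y k))"
proof -
  define F where "F u v = real_of_ereal (f u v)" for u v
  define H1 where "H1 u = real_of_ereal (h1 u)" for u
  define H2 where "H2 v = real_of_ereal (h2 v)" for v
  define N where "N = 128 * M\<^sup>2 * D\<^sup>2 / \<epsilon>\<^sup>2"
  have lam: "lam > 0" using eps_pos M_pos by (simp add: lam_def)
  have x0: "x0 \<in> edom h1" and y0: "y0 \<in> edom h2" using start by auto
  have f_fin: "\<bar>f u v\<bar> \<noteq> \<infinity>" if "u \<in> edom h1" "v \<in> edom h2" for u v
    using dom_f that by (auto simp: saddle_dom_def)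
  have bd1: "bounded (edom h1)" and bd2: "bounded (edom h2)"
    using bounded_fst[OF dom_bounded] bounded_snd[OF dom_bounded] x0 y0
    by (auto simp: fst_image_times snd_image_times split: if_splits)
  have conv1: "convex (edom h1)" and conv2: "convex (edom h2)"
    using convex_edom h1 h2 by auto
  have cvx_H1: "convex_on (edom h1) H1" and cvx_H2: "convex_on (edom h2) H2"
    using convex_on_edom h1 h2 by (auto simp: H1_def[abs_def] H2_def[abs_def])
  have cvx_F1: "convex_on (edom h1) (\<lambda>u. F u v)" if "v \<in> edom h2" for v
    using econvex_convex_on[OF f_convex conv1, of v] f_fin that by (simp add: F_def)
  have cvx_F2: "convex_on (edom h2) (\<lambda>v. - F u v)" if "u \<in> edom h1" for u
    using econvex_convex_on[OF f_concave[unfolded econcave_fun_def] conv2, of u] f_fin that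
    by (simp add: F_def)

  have sub1: "F u v + fx u v \<bullet> (w - u) \<le> F w v"
    if "u \<in> edom h1" "w \<in> edom h1" "v \<in> edom h2" for u w v
    using is_subgradient_real[OF fx] f_fin that by (simp add: F_def)
  have sub2: "F u w \<le> F u v + fy u v \<bullet> (w - v)"
    if "u \<in> edom h1" "v \<in> edom h2" "w \<in> edom h2" for u w v
    using is_subgradient_real[OF fy[unfolded is_supergradient_uminus], of u v w] f_fin that
    by (simp add: F_def)
  have Lip1: "F u v \<le> F w v + M * norm (u - w)"
    if "u \<in> edom h1" "w \<in> edom h1" "v \<in> edom h2" for u w v
    using sub1[OF that] Cauchy_Schwarz_ineq2[of "fx u v" "w - u"]
      mult_right_mono[OF fx_bound[OF that(1,3)], of "norm (w - u)"]
    by (simp add: abs_le_iff norm_minus_commute)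
  have Lip2: "F u w \<le> F u v + M * norm (v - w)"
    if "u \<in> edom h1" "v \<in> edom h2" "w \<in> edom h2" for u w v
    using sub2[OF that] Cauchy_Schwarz_ineq2[of "fy u v" "w - v"]
      mult_right_mono[OF fy_bound[OF that(1,2)], of "norm (w - v)"]
    by (simp add: abs_le_iff norm_minus_commute)

  have x_0: "x 0 = x0" and y_0: "y 0 = y0" by (simp_all add: x_def y_def)
  have x_Suc: "x (Suc i) = cs_step_x f fx h1 lam (x i) (y i)"
    and y_Suc: "y (Suc i) = cs_step_x (\<lambda>v u. - f u v) (\<lambda>v u. - fy u v) h2 lam (y i) (x i)" for i
    by (simp_all add: x_def y_def cs_step_y_eq_cs_step_x[symmetric] split: prod.split)
  have progress1: "x (Suc i) \<in> edom h1"
    "u \<in> edom h1 \<Longrightarrow> H1 (x (Suc i)) + M * norm (x (Suc i) - x i)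
        \<le> H1 u + fx (x i) (y i) \<bullet> (u - x i)
          + ((norm (u - x i))\<^sup>2 - (norm (u - x (Suc i)))\<^sup>2) / (2 * lam) + 2 * lam * M\<^sup>2"
    if "x i \<in> edom h1" "y i \<in> edom h2" for i u
    using cs_step_x_progress[where f = f and fx = fx and x = "x i" and y = "y i",
        OF h1 bd1 f_fin[OF that] fx_bound[OF that] lam]
    unfolding H1_def x_Suc by blast+
  have progress2: "y (Suc i) \<in> edom h2"
    "v \<in> edom h2 \<Longrightarrow> H2 (y (Suc i)) + M * norm (y (Suc i) - y i)
        \<le> H2 v - fy (x i) (y i) \<bullet> (v - y i)
          + ((norm (v - y i))\<^sup>2 - (norm (v - y (Suc i)))\<^sup>2) / (2 * lam) + 2 * lam * M\<^sup>2"
    if "x i \<in> edom h1" "y i \<in> edom h2" for i v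
    using cs_step_x_progress[where f = "\<lambda>v u. - f u v" and fx = "\<lambda>v u. - fy u v"
        and x = "y i" and y = "x i" and M = M, OF h2 bd2 _ _ lam]
      f_fin[OF that] fy_bound[OF that]
    unfolding H2_def y_Suc by (simp_all add: ereal_uminus_eq_reorder)
  have mem: "x i \<in> edom h1 \<and> y i \<in> edom h2" for i
    by (induction i) (use x0 y0 progress1(1) progress2(1) in \<open>auto simp: x_0 y_0\<close>)
  then have xm: "x i \<in> edom h1" and ym: "y i \<in> edom h2" for i by auto

  have rate: "spp_obj f h1 h2 (iter_avg x k) v - spp_obj f h1 h2 u (iter_avg y k)
      \<le> ereal (\<epsilon> / 8 + 16 * M\<^sup>2 * D\<^sup>2 / (\<epsilon> * real k))"
    if k: "k \<ge> 1" and u: "u \<in> edom h1" and v: "v \<in> edom h2" for k u v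
  proof -
    define gap where "gap p q = F p v + H1 p - H2 v - (F u q + H1 u - H2 q)" for p q
    define a where "a i = (norm (u - x i))\<^sup>2 + (norm (v - y i))\<^sup>2" for i
    have step: "gap (x (Suc i)) (y (Suc i)) \<le> (a i - a (Suc i)) / (2 * lam) + 4 * lam * M\<^sup>2" for i
      using progress1(2)[OF xm ym u, of i] progress2(2)[OF xm ym v, of i]
        sub1[OF xm u ym, of i i] sub2[OF xm ym v, of i i]
        Lip1[OF xm xm v, of "Suc i" i] Lip2[OF u ym ym, of i "Suc i"]
      by (simp add: gap_def a_def add_divide_distrib diff_divide_distrib)
    have telescope: "(\<Sum>i=1..n. gap (x i) (y i)) \<le> (a 0 - a n) / (2 * lam) + real n * (4 * lam * M\<^sup>2)"
      for n
    proof (induction n)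
      case (Suc n)
      then show ?case using step[of n] by (simp add: algebra_simps diff_divide_distrib)
    qed simp
    have a0: "a 0 \<le> D\<^sup>2"
    proof -
      have "dist (u, v) (x0, y0) \<le> D"
        unfolding D_def using u v x0 y0 by (intro diameter_bounded_bound[OF dom_bounded]) auto
      then have "(dist (u, v) (x0, y0))\<^sup>2 \<le> D\<^sup>2" by (intro power_mono) auto
      then show ?thesis by (simp add: a_def x_0 y_0 dist_norm norm_Pair)
    qed
    have "real k * gap (iter_avg x k) (iter_avg y k) \<le> (\<Sum>i=1..k. gap (x i) (y i))"
      using iter_avg_Jensen[where z = x, OF cvx_F1[OF v] xm k]
        iter_avg_Jensen[where z = y, OF cvx_F2[OF u] ym k]
        iter_avg_Jensen[where z = x, OF cvx_H1 xm k]
        iter_avg_Jensen[where z = y, OF cvx_H2 ym k]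
      by (simp add: gap_def sum.distrib sum_subtractf sum_negf algebra_simps)
    also have "\<dots> \<le> D\<^sup>2 / (2 * lam) + real k * (4 * lam * M\<^sup>2)"
    proof -
      have "a k \<ge> 0" by (simp add: a_def)
      then have "(a 0 - a k) / (2 * lam) \<le> D\<^sup>2 / (2 * lam)"
        using a0 lam by (intro divide_right_mono) auto
      then show ?thesis using telescope[of k] by linarith
    qed
    also have "\<dots> = real k * (\<epsilon> / 8 + 16 * M\<^sup>2 * D\<^sup>2 / (\<epsilon> * real k))"
      using k eps_pos M_pos by (simp add: lam_def field_simps)
    finally have "gap (iter_avg x k) (iter_avg y k) \<le> \<epsilon> / 8 + 16 * M\<^sup>2 * D\<^sup>2 / (\<epsilon> * real k)"
      using k by simp
    moreover have "spp_obj f h1 h2 p q = ereal (F p q + H1 p - H2 q)"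
      if "p \<in> edom h1" "q \<in> edom h2" for p q
      using f_fin[OF that] finite_on_edom[OF h1(1) that(1)] finite_on_edom[OF h2(1) that(2)]
      unfolding spp_obj_def F_def H1_def H2_def
      by (cases "f p q"; cases "h1 p"; cases "h2 q") auto
    ultimately show ?thesis
      using u v iter_avg_mem[where z = x, OF conv1 xm k]
        iter_avg_mem[where z = y, OF conv2 ym k] by (simp add: gap_def)
  qed
  \<comment> \<open>The factor 2 makes room for rounding \<open>N\<close> down, because \<open>N \<le> 2 * \<lfloor>N\<rfloor>\<close>
    for \<open>N \<ge> 1\<close>.\<close>
  have saddle: "is_eps_saddle_point f h1 h2 \<epsilon> (iter_avg x k) (iter_avg y k)"
    if k: "k \<ge> 1" "N \<le> 2 * real k" for k
  proof -
    have "16 * M\<^sup>2 * D\<^sup>2 / (\<epsilon> * real k) \<le> \<epsilon> / 4"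
      using k eps_pos by (simp add: N_def field_simps power2_eq_square)
    then have "\<epsilon> / 8 + 16 * M\<^sup>2 * D\<^sup>2 / (\<epsilon> * real k) \<le> \<epsilon>" using eps_pos by linarith
    then show ?thesis
      unfolding is_eps_saddle_point_def
      using rate[OF k(1)] iter_avg_mem[where z = x, OF conv1 xm k(1)]
        iter_avg_mem[where z = y, OF conv2 ym k(1)]
      by (meson ereal_less_eq(3) order_trans)
  qed
  define k where "k = max 1 (nat \<lfloor>N\<rfloor>)"
  have "k \<ge> 1" "real k \<le> max 1 N" "N \<le> 2 * real k"
    unfolding k_def by (linarith | simp add: max_def)+
  then show ?thesis
    using saddle unfolding N_def[symmetric] by (smt (verit) of_nat_0_le_iff)
qed

end
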